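(* Let $\phi=\frac{1+\sqrt5}{2}$, and let $$U=\begin{pmatrix}1&\phi\\0&1\end{pmatrix},\qquad L=\begin{pmatrix}1&0\\ \phi&1\end{pmatrix},\qquad e_1=\begin{pmatrix}1\\0\end{pmatrix}.$$ Let $\Gamma=\langle U,L\rangle$ be the group generated by $U$ and $L$, acting linearly on $\mathbb{R}^2$. Then for any positive integer $K$, there exist $\gamma_0,\ldots,\gamma_{K-1}\in\Gamma$ and a ball $B\subset\mathbb{R}^2$ of radius $1$ such that the vectors $\gamma_0e_1,\ldots,\gamma_{K-1}e_1$ all lie in $B$ and are (pairwise) distinct.
   Context: $\mathbb{R}^2$ carries the standard Euclidean metric; $\Gamma$ is a subgroup of $SL_2(\mathbb{R})$ and acts on column vectors by matrix multiplication. *)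

theory Defs
  imports "HOL-Analysis.Analysis" "HOL-Algebra.Generated_Groups"
begin

definition SL2R :: "(real^2^2) monoid" where
  "SL2R = \<lparr>carrier = {A. det A = 1}, monoid.mult = (**), one = mat 1\<rparr>"

lemma group_SL2R: "group SL2R"
proof (rule groupI)
  fix A :: "real^2^2"
  assume "A \<in> carrier SL2R"
  then have det: "det A = 1"
    by (simp add: SL2R_def)
  then obtain B where B: "A ** B = mat 1" "B ** A = mat 1"
    by (metis invertible_def invertible_det_nz zero_neq_one)
  then have "det B = 1"
    using det by (metis det_I det_mul mult_1)
  with B show "\<exists>C\<in>carrier SL2R. C \<otimes>\<^bsub>SL2R\<^esub> A = \<one>\<^bsub>SL2R\<^esub>"
    by (auto simp: SL2R_def)
qed (auto simp: SL2R_def det_mul matrix_mul_assoc)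

definition phi :: real where
  "phi = (1 + sqrt 5) / 2"

definition U :: "real^2^2" where
  "U = vector [vector [1, phi], vector [0, 1]]"

definition L :: "real^2^2" where
  "L = vector [vector [1, 0], vector [phi, 1]]"

definition e1 :: "real^2" where
  "e1 = vector [1, 0]"

lemma U_L_in_SL2R: "{U, L} \<subseteq> carrier SL2R"
  by (simp add: SL2R_def U_def L_def det_2)

definition Gam :: "(real^2^2) set" where
  "Gam = generate SL2R {U, L}"

lemma subgroup_Gam: "subgroup Gam SL2R"
  unfolding Gam_def
  using group.generate_is_subgroup[OF group_SL2R U_L_in_SL2R] .

end

theory Submission
  imports Defs "HOL-Number_Theory.Cong"
begin

text \<open>
  The horizontal shears \<open>U\<^sup>n\<close> act on a point of height \<open>y\<close> by translating its first coordinate by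
  \<open>n * phi * y\<close>.  If \<open>K\<close> orbit points have almost equal, but distinct, heights \<open>y i\<close>, it
  therefore suffices to choose integers \<open>n i\<close> so that all \<open>x i + n i * phi * y i\<close> are almost
  equal.  Two ideas make this possible.

  If the heights form an arithmetic progression \<open>y i = y 0 + i * h\<close>, then suitable \<open>n i\<close>
  always exist, with an error that is a multiple of \<open>\<bar>h\<bar>\<close> depending only on \<open>K\<close>.  Indeed, write \<open>n\<close> in the
  Newton basis, \<open>n i = (\<Sum>j. (i choose j) * m j)\<close>.  Multiplication by a function that is affine in
  \<open>i\<close> is bidiagonal in this basis, so the \<open>j\<close>-th finite difference of \<open>x i + n i * phi * y i\<close>
  involves only \<open>m j\<close> and \<open>m (j - 1)\<close>, the latter with the coefficient \<open>j * phi * h\<close>.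
  Descending in \<open>j\<close>, rounding yields an integer \<open>m (j - 1)\<close> that makes this difference at most
  \<open>j * phi * \<bar>h\<bar> / 2\<close> (\<open>simultaneous_near_residue\<close>).

  It remains to find \<open>K\<close> heights in arithmetic progression with a tiny common difference.  The
  height of \<open>L\<^sup>b U\<^sup>a L e1\<close> is \<open>phi * (1 + b + a * b * phi\<^sup>2)\<close>.  As \<open>phi\<^sup>2\<close> is irrational, there
  are integers \<open>G\<close> and \<open>F\<close> with \<open>G - F * phi\<^sup>2\<close> positive and arbitrarily small, and the choice
  \<open>b = 1 + i * G\<close>, \<open>a * b = p - i * F\<close> gives the desired progression.  Such an \<open>a\<close> exists for every
  \<open>i\<close> as soon as \<open>G * p \<equiv> - F\<close> modulo the product of the \<open>1 + i * G\<close>, which is coprime to \<open>G\<close>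
  (\<open>progression_divisibility\<close>).
\<close>

section \<open>Simultaneous residues for moduli in arithmetic progression\<close>

lemma newton_expansion_exists:
  fixes x :: "nat \<Rightarrow> real"
  shows "\<exists>d. \<forall>i<K. x i = (\<Sum>j\<le>i. real (i choose j) * d j)"
proof (induction K)
  case 0
  then show ?case by simp
next
  case (Suc K)
  then obtain d where d: "x i = (\<Sum>j\<le>i. real (i choose j) * d j)" if "i < K" for i
    by blast
  define d' where "d' = d(K := x K - (\<Sum>j<K. real (K choose j) * d j))"
  have "x i = (\<Sum>j\<le>i. real (i choose j) * d' j)" if "i < Suc K" for i
  proof (cases "i = K")
    case True
    have "(\<Sum>j\<le>K. real (K choose j) * d' j) = (\<Sum>j<K. real (K choose j) * d' j) + d' K"
      by (simp add: lessThan_Suc_atMost[symmetric])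
    also have "(\<Sum>j<K. real (K choose j) * d' j) = (\<Sum>j<K. real (K choose j) * d j)"
      by (intro sum.cong) (auto simp: d'_def)
    finally show ?thesis using True by (simp add: d'_def)
  next
    case False
    have "(\<Sum>j\<le>i. real (i choose j) * d' j) = (\<Sum>j\<le>i. real (i choose j) * d j)"
      using False that by (intro sum.cong) (auto simp: d'_def)
    then show ?thesis using d[of i] False that by simp
  qed
  then show ?case by blast
qed

text \<open>
  Back substitution in a bidiagonal system, with rounding: each equation is solved for the unknown
  of smaller index, and rounding this unknown costs at most half of its coefficient.
\<close>

lemma bidiagonal_rounding:
  fixes \<alpha> \<beta> \<xi> :: "nat \<Rightarrow> real" and M :: int
  assumes "\<And>j. j < K \<Longrightarrow> \<beta> j \<noteq> 0"
  shows "\<exists>m :: nat \<Rightarrow> int. m K = M \<and>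
           (\<forall>j<K. \<bar>\<alpha> j * m (Suc j) + \<beta> j * m j + \<xi> j\<bar> \<le> \<bar>\<beta> j\<bar> / 2)"
  using assms
proof (induction K arbitrary: M)
  case 0
  then show ?case by auto
next
  case (Suc K)
  define q where "q = - (\<alpha> K * M + \<xi> K) / \<beta> K"
  obtain m where m: "m K = round q"
    "\<And>j. j < K \<Longrightarrow> \<bar>\<alpha> j * m (Suc j) + \<beta> j * m j + \<xi> j\<bar> \<le> \<bar>\<beta> j\<bar> / 2"
    using Suc.IH[of "round q"] Suc.prems by auto
  have "\<beta> K * q = - (\<alpha> K * M + \<xi> K)"
    using Suc.prems[of K] by (simp add: q_def)
  then have "\<alpha> K * M + \<beta> K * round q + \<xi> K = \<beta> K * (round q - q)"
    by (simp add: algebra_simps)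
  moreover have "\<bar>\<beta> K * (round q - q)\<bar> \<le> \<bar>\<beta> K\<bar> * (1 / 2)"
    unfolding abs_mult by (intro mult_left_mono of_int_round_abs_le) simp
  ultimately have last: "\<bar>\<alpha> K * M + \<beta> K * round q + \<xi> K\<bar> \<le> \<bar>\<beta> K\<bar> / 2"
    by simp
  show ?case
    by (rule exI[of _ "m(Suc K := M)"]) (use m last in \<open>auto simp: less_Suc_eq\<close>)
qed

text \<open>
  Multiplication by \<open>i\<close> in the Newton basis: the absorption identity
  \<open>(i - j) * (i choose j) = (j + 1) * (i choose (j + 1))\<close> moves the part that is not diagonal to the
  next basis element.
\<close>

lemma newton_basis_mult_affine:
  fixes m :: "nat \<Rightarrow> real"
  shows "(\<Sum>j\<le>i. real (i choose j) * m j) * (Y + real i * h) =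
         m 0 * Y + (\<Sum>j<i. real (i choose Suc j) *
            ((Y + real (Suc j) * h) * m (Suc j) + real (Suc j) * h * m j))"
proof -
  have absorb: "real (i choose j) * (real i - real j) = real (Suc j) * real (i choose Suc j)"
    if "j < i" for j
  proof -
    have "Suc j * (i choose Suc j) = (i - j) * (i choose j)"
      using binomial_absorb_comp[of i j] binomial_absorption[of j i] by simp
    then have "real (Suc j * (i choose Suc j)) = real ((i - j) * (i choose j))"
      by (rule arg_cong)
    then show ?thesis using that by (simp only: of_nat_mult of_nat_diff[OF less_imp_le] mult.commute)
  qed
  have "(\<Sum>j\<le>i. real (i choose j) * m j) * (Y + real i * h) =
        (\<Sum>j\<le>i. real (i choose j) * (Y + real j * h) * m j) +
        (\<Sum>j\<le>i. real (i choose j) * (real i - real j) * h * m j)"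
    by (simp add: sum_distrib_left sum_distrib_right sum.distrib[symmetric] algebra_simps)
  also have "(\<Sum>j\<le>i. real (i choose j) * (Y + real j * h) * m j) =
      Y * m 0 + (\<Sum>j<i. real (i choose Suc j) * (Y + real (Suc j) * h) * m (Suc j))"
    by (subst sum.atMost_shift) simp
  also have "(\<Sum>j\<le>i. real (i choose j) * (real i - real j) * h * m j) =
      (\<Sum>j<i. real (i choose j) * (real i - real j) * h * m j)"
    by (simp add: lessThan_Suc_atMost[symmetric])
  also have "\<dots> = (\<Sum>j<i. real (Suc j) * real (i choose Suc j) * h * m j)"
    by (intro sum.cong) (auto simp: absorb simp del: of_nat_Suc)
  finally show ?thesis
    by (simp add: sum.distrib[symmetric] algebra_simps)
qed

lemma simultaneous_near_residue:
  fixes x :: "nat \<Rightarrow> real" and Y h :: real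
  assumes "h \<noteq> 0"
  shows "\<exists>(n :: nat \<Rightarrow> int) T. \<forall>i<K. \<bar>x i + n i * (Y + real i * h) - T\<bar> \<le> 2 ^ K * real K * \<bar>h\<bar> / 2"
proof -
  obtain d where d: "\<And>i. i < K \<Longrightarrow> x i = (\<Sum>j\<le>i. real (i choose j) * d j)"
    using newton_expansion_exists by blast
  obtain m :: "nat \<Rightarrow> int" where
    m: "\<And>j. j < K \<Longrightarrow> \<bar>(Y + real (Suc j) * h) * m (Suc j) + real (Suc j) * h * m j + d (Suc j)\<bar>
           \<le> \<bar>real (Suc j) * h\<bar> / 2"
    using bidiagonal_rounding[where \<alpha> = "\<lambda>j. Y + real (Suc j) * h" and \<beta> = "\<lambda>j. real (Suc j) * h"
        and \<xi> = "\<lambda>j. d (Suc j)" and M = 0 and K = K] assms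
    by auto
  define E where
    "E j = (Y + real (Suc j) * h) * m (Suc j) + real (Suc j) * h * m j + d (Suc j)" for j
  define n where "n i = (\<Sum>j\<le>i. int (i choose j) * m j)" for i
  have "\<bar>x i + n i * (Y + real i * h) - (d 0 + m 0 * Y)\<bar> \<le> 2 ^ K * real K * \<bar>h\<bar> / 2"
    if i: "i < K" for i
  proof -
    have "n i * (Y + real i * h) = (\<Sum>j\<le>i. real (i choose j) * real_of_int (m j)) * (Y + real i * h)"
      by (simp add: n_def)
    moreover have "x i = d 0 + (\<Sum>j<i. real (i choose Suc j) * d (Suc j))"
      unfolding d[OF i] by (subst sum.atMost_shift) simp
    ultimately have "x i + n i * (Y + real i * h) - (d 0 + m 0 * Y) =
        (\<Sum>j<i. real (i choose Suc j) * E j)"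
      unfolding newton_basis_mult_affine
      by (simp add: E_def distrib_left sum.distrib del: of_nat_Suc)
    also have "\<bar>\<dots>\<bar> \<le> (\<Sum>j<i. real (i choose Suc j) * (real K * \<bar>h\<bar> / 2))"
    proof (intro order.trans[OF sum_abs] sum_mono)
      fix j assume j: "j \<in> {..<i}"
      then have "\<bar>E j\<bar> \<le> \<bar>real (Suc j) * h\<bar> / 2"
        using m[of j] i by (simp add: E_def)
      also have "\<dots> = real (Suc j) * \<bar>h\<bar> / 2"
        by (simp add: abs_mult)
      also have "\<dots> \<le> real K * \<bar>h\<bar> / 2"
        using j i by (intro divide_right_mono mult_right_mono) auto
      finally show "\<bar>real (i choose Suc j) * E j\<bar> \<le> real (i choose Suc j) * (real K * \<bar>h\<bar> / 2)"
        by (simp only: abs_mult abs_of_nat mult_left_mono of_nat_0_le_iff)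
    qed
    also have "\<dots> = real (\<Sum>j<i. i choose Suc j) * (real K * \<bar>h\<bar> / 2)"
      by (simp add: sum_distrib_right sum_divide_distrib)
    also have "\<dots> \<le> 2 ^ K * (real K * \<bar>h\<bar> / 2)"
    proof (intro mult_right_mono)
      have "(\<Sum>j<i. i choose Suc j) \<le> (\<Sum>j\<le>i. i choose j)"
        by (simp add: sum.atMost_shift)
      also have "\<dots> = 2 ^ i"
        by (rule choose_row_sum)
      also have "\<dots> \<le> 2 ^ K"
        using i by simp
      finally show "real (\<Sum>j<i. i choose Suc j) \<le> 2 ^ K"
        by (metis of_nat_le_iff of_nat_numeral of_nat_power)
    qed simp
    finally show ?thesis by simp
  qed
  then show ?thesis by blast
qed

section \<open>Heights in arithmetic progression\<close>

lemma phi_square: "phi\<^sup>2 = phi + 1"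
  by (simp add: phi_def power2_eq_square field_simps)

lemma phi_bounds: "1 < phi" "phi < 2"
proof -
  have "1 < sqrt 5"
    by simp
  moreover have "sqrt 5 < 3"
    by (rule real_less_lsqrt) auto
  ultimately show "1 < phi" "phi < 2"
    by (auto simp: phi_def)
qed

text \<open>
  The number \<open>3 - phi\<^sup>2 = 2 - phi\<close> is a unit between 0 and 1, and its powers stay in
  \<open>\<int> + \<int> phi\<^sup>2\<close> because \<open>phi ^ 4 = 3 * phi\<^sup>2 - 1\<close>.
\<close>

lemma small_integer_combination:
  fixes \<epsilon> :: real
  assumes "0 < \<epsilon>"
  shows "\<exists>(G :: int) (F :: int). 0 < G - F * phi\<^sup>2 \<and> G - F * phi\<^sup>2 < \<epsilon>"
proof -
  have power: "\<exists>(G :: int) (F :: int). (2 - phi) ^ n = G - F * phi\<^sup>2" for n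
  proof (induction n)
    case 0
    show ?case by (rule exI[of _ 1], rule exI[of _ 0]) simp
  next
    case (Suc n)
    then obtain G :: int and F :: int where GF: "(2 - phi) ^ n = G - F * phi\<^sup>2" by blast
    have "(2 - phi) ^ Suc n = (2 - phi) * (G - F * (phi + 1))"
      by (simp add: GF phi_square)
    also have "\<dots> = (3 * G - F) - G * (phi + 1) + F * (phi * phi - phi - 1)"
      by (simp add: algebra_simps)
    also have "\<dots> = (3 * G - F :: int) - G * phi\<^sup>2"
      using phi_square by (simp add: power2_eq_square)
    finally show ?case by blast
  qed
  obtain n where "(2 - phi) ^ n < \<epsilon>"
    using real_arch_pow_inv[OF assms, of "2 - phi"] phi_bounds by auto
  moreover have "0 < (2 - phi) ^ n"
    using phi_bounds by simp
  ultimately show ?thesis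
    using power[of n] by metis
qed

text \<open>
  Modulo \<open>1 + i * G\<close>, the number \<open>G\<close> is invertible with inverse \<open>- i\<close>, so \<open>p \<equiv> i * F\<close> is the same as
  \<open>G * p \<equiv> - F\<close>; the latter congruence does not mention \<open>i\<close> and can be imposed modulo the product
  of all the \<open>1 + i * G\<close> at once.
\<close>

lemma progression_divisibility:
  fixes G F :: int
  shows "\<exists>p. \<forall>i<K. 1 + int i * G dvd p - int i * F"
proof -
  have coprime_b: "coprime G (1 + int i * G)" for i
    using gcd_add_mult[of G "int i" 1] by (simp add: coprime_iff_gcd_eq_1 add.commute)
  then have "coprime G (\<Prod>i<K. 1 + int i * G)"
    by (intro prod_coprime_right)
  then obtain r where r: "[G * r = 1] (mod (\<Prod>i<K. 1 + int i * G))"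
    using cong_solve_coprime_int by blast
  have "1 + int i * G dvd - (F * r) - int i * F" if "i < K" for i
  proof -
    have "1 + int i * G dvd (\<Prod>i<K. 1 + int i * G)"
      using that by (intro dvd_prodI) auto
    then have "1 + int i * G dvd G * r - 1"
      using r by (meson cong_iff_dvd_diff dvd_trans)
    then have "1 + int i * G dvd - F * (G * r - 1) - F * (1 + int i * G)"
      by (rule dvd_diff[OF dvd_mult dvd_triv_right])
    also have "- F * (G * r - 1) - F * (1 + int i * G) = G * (- (F * r) - int i * F)"
      by (simp add: algebra_simps)
    finally show ?thesis
      using coprime_b[of i] by (simp only: coprime_dvd_mult_right_iff coprime_commute)
  qed
  then show ?thesis by blast
qed

section \<open>The orbit of the first basis vector\<close>

definition upper_shear :: "real \<Rightarrow> real^2^2" where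
  "upper_shear s = vector [vector [1, s], vector [0, 1]]"

definition lower_shear :: "real \<Rightarrow> real^2^2" where
  "lower_shear s = vector [vector [1, 0], vector [s, 1]]"

lemma upper_shear_mult: "upper_shear s ** upper_shear t = upper_shear (s + t)"
  by (simp add: upper_shear_def matrix_matrix_mult_def vec_eq_iff forall_2 sum_2)

lemma lower_shear_mult: "lower_shear s ** lower_shear t = lower_shear (s + t)"
  by (simp add: lower_shear_def matrix_matrix_mult_def vec_eq_iff forall_2 sum_2)

lemma shear_0: "upper_shear 0 = mat 1" "lower_shear 0 = mat 1"
  by (simp_all add: upper_shear_def lower_shear_def mat_def vec_eq_iff forall_2)

lemma upper_shear_apply: "upper_shear s *v vector [x, y] = vector [x + s * y, y]"
  by (simp add: upper_shear_def matrix_vector_mult_def vec_eq_iff forall_2 sum_2)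

lemma lower_shear_apply: "lower_shear s *v vector [x, y] = vector [x, s * x + y]"
  by (simp add: lower_shear_def matrix_vector_mult_def vec_eq_iff forall_2 sum_2)

lemma Gam_mult: "A \<in> Gam \<Longrightarrow> B \<in> Gam \<Longrightarrow> A ** B \<in> Gam"
  using subgroup.m_closed[OF subgroup_Gam] by (simp add: SL2R_def)

lemma one_parameter_in_Gam:
  fixes S :: "real \<Rightarrow> real^2^2" and s :: real and n :: int
  assumes mult: "\<And>s t. S s ** S t = S (s + t)" and zero: "S 0 = mat 1" and gen: "S s \<in> Gam"
  shows "S (n * s) \<in> Gam"
proof -
  have "S (- s) ** S s = mat 1"
    by (simp add: mult zero)
  moreover from this have "det (S (- s)) * det (S s) = 1"
    by (metis det_I det_mul)
  moreover have "det (S s) = 1"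
    using subgroup.mem_carrier[OF subgroup_Gam gen] by (simp add: SL2R_def)
  ultimately have "inv\<^bsub>SL2R\<^esub> (S s) = S (- s)"
    by (intro group.inv_equality[OF group_SL2R]) (auto simp: SL2R_def)
  then have inv: "S (- s) \<in> Gam"
    using subgroup.m_inv_closed[OF subgroup_Gam gen] by simp
  show ?thesis
  proof (induction n rule: int_induct[where k = 0])
    case base
    then show ?case
      using subgroup.one_closed[OF subgroup_Gam] by (simp add: zero SL2R_def)
  next
    case (step1 i)
    then show ?case
      using Gam_mult[OF step1(2) gen] by (simp add: mult algebra_simps)
  next
    case (step2 i)
    then show ?case
      using Gam_mult[OF step2(2) inv] by (simp add: mult algebra_simps)
  qed
qed

lemma shears_in_Gam:
  fixes n :: int
  shows "upper_shear (n * phi) \<in> Gam" "lower_shear (n * phi) \<in> Gam"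
proof -
  have "upper_shear phi \<in> Gam" "lower_shear phi \<in> Gam"
    by (auto simp: Gam_def upper_shear_def lower_shear_def U_def L_def intro: generate.incl)
  then show "upper_shear (n * phi) \<in> Gam" "lower_shear (n * phi) \<in> Gam"
    by (auto intro: one_parameter_in_Gam upper_shear_mult lower_shear_mult shear_0)
qed

lemma orbit_point:
  fixes n a b :: int
  defines "y \<equiv> phi * (1 + b + (a * b) * phi\<^sup>2)"
  shows "\<exists>\<gamma>\<in>Gam. \<gamma> *v e1 = vector [1 + a * phi\<^sup>2 + n * (phi * y), y]"
proof
  let ?\<gamma> = "upper_shear (n * phi) ** (lower_shear (b * phi) **
              (upper_shear (a * phi) ** lower_shear ((1 :: int) * phi)))"
  show "?\<gamma> \<in> Gam"
    by (intro Gam_mult shears_in_Gam)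
  show "?\<gamma> *v e1 = vector [1 + a * phi\<^sup>2 + n * (phi * y), y]"
    by (simp add: matrix_vector_mul_assoc[symmetric] e1_def upper_shear_apply lower_shear_apply
        y_def power2_eq_square algebra_simps)
qed

theorem proposition2p1:
  fixes K :: nat
  assumes "K > 0"
  shows "\<exists>(\<gamma> :: nat \<Rightarrow> real^2^2) (c :: real^2).
           (\<forall>i<K. \<gamma> i \<in> Gam) \<and>
           (\<forall>i<K. \<gamma> i *v e1 \<in> ball c 1) \<and>
           inj_on (\<lambda>i. \<gamma> i *v e1) {..<K}"
proof -
  \<comment> \<open>With this bound both coordinates of the orbit points vary by less than \<open>1 / 2\<close> around the
    center; a factor 2 absorbs \<open>phi < 2\<close> in the step \<open>h\<close>.\<close>
  define \<epsilon> :: real where "\<epsilon> = 1 / (2 ^ K * real K * 4)"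
  have "0 < \<epsilon>"
    using assms by (simp add: \<epsilon>_def)
  then obtain G :: int and F :: int where GF: "0 < G - F * phi\<^sup>2" "G - F * phi\<^sup>2 < \<epsilon>"
    using small_integer_combination by blast
  define h where "h = phi * (G - F * phi\<^sup>2)"
  have h: "0 < h"
    using GF phi_bounds by (simp add: h_def)
  have "h < 2 * \<epsilon>"
    unfolding h_def using GF phi_bounds by (intro mult_strict_mono) auto
  then have small: "2 ^ K * real K * h < 1 / 2"
    using assms by (simp add: \<epsilon>_def field_simps)
  obtain p where "\<forall>i<K. 1 + int i * G dvd p - int i * F"
    using progression_divisibility by blast
  then obtain a where a: "\<And>i. i < K \<Longrightarrow> p - int i * F = (1 + int i * G) * a i"
    unfolding dvd_def by metis
  \<comment> \<open>The height of the \<open>i\<close>-th point, for the shear exponents \<open>a i\<close> and \<open>b = 1 + i * G\<close>: as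
    \<open>a i * b = p - i * F\<close>, it is affine in \<open>i\<close> with slope \<open>h\<close>.\<close>
  define y where "y i = phi * (2 + p * phi\<^sup>2) + real i * h" for i
  have y: "y i = phi * (1 + (1 + int i * G) + (a i * (1 + int i * G)) * phi\<^sup>2)" if "i < K" for i
  proof -
    have "real_of_int (a i * (1 + int i * G)) = p - real i * F"
      using arg_cong[OF a[OF that], of real_of_int] by (simp add: mult.commute)
    then show ?thesis
      by (simp only:) (simp add: y_def h_def algebra_simps)
  qed
  have "phi * h \<noteq> 0"
    using h phi_bounds by simp
  then obtain n :: "nat \<Rightarrow> int" and T where
    n: "\<And>i. i < K \<Longrightarrow>
      \<bar>(1 + a i * phi\<^sup>2) + n i * (phi * y 0 + real i * (phi * h)) - T\<bar>
        \<le> 2 ^ K * real K * \<bar>phi * h\<bar> / 2"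
    using simultaneous_near_residue[of "phi * h" K "\<lambda>i. 1 + a i * phi\<^sup>2" "phi * y 0"] by blast
  have "\<forall>i. \<exists>\<gamma>. i < K \<longrightarrow> \<gamma> \<in> Gam \<and> \<gamma> *v e1 = vector [1 + a i * phi\<^sup>2 + n i * (phi * y i), y i]"
    using orbit_point y by metis
  then obtain \<gamma> where \<gamma>: "\<And>i. i < K \<Longrightarrow> \<gamma> i \<in> Gam"
    "\<And>i. i < K \<Longrightarrow> \<gamma> i *v e1 = vector [1 + a i * phi\<^sup>2 + n i * (phi * y i), y i]"
    by metis
  have "\<gamma> i *v e1 \<in> ball (vector [T, y 0]) 1" if i: "i < K" for i
  proof -
    have "phi * y i = phi * y 0 + real i * (phi * h)"
      by (simp add: y_def algebra_simps)
    then have "\<bar>1 + a i * phi\<^sup>2 + n i * (phi * y i) - T\<bar> \<le> 2 ^ K * real K * \<bar>phi * h\<bar> / 2"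
      using n[OF i] by simp
    also have "\<dots> = 2 ^ K * real K * h * (phi / 2)"
      using h phi_bounds by (simp add: abs_mult)
    also have "\<dots> \<le> 2 ^ K * real K * h * 1"
      using h phi_bounds by (intro mult_left_mono) auto
    finally have xdiff: "\<bar>1 + a i * phi\<^sup>2 + n i * (phi * y i) - T\<bar> < 1 / 2"
      using small by simp
    have "\<bar>y i - y 0\<bar> = 1 * real i * h"
      using h by (simp add: y_def)
    also have "\<dots> \<le> 2 ^ K * real K * h"
      using i h by (intro mult_mono) auto
    finally have ydiff: "\<bar>y i - y 0\<bar> < 1 / 2"
      using small by simp
    have "dist (\<gamma> i *v e1) (vector [T, y 0]) \<le>
        \<bar>1 + a i * phi\<^sup>2 + n i * (phi * y i) - T\<bar> + \<bar>y i - y 0\<bar>"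
      unfolding dist_norm \<gamma>(2)[OF i]
      by (rule order.trans[OF norm_le_l1_cart]) (simp add: sum_2)
    then show ?thesis
      using xdiff ydiff by (simp add: dist_commute)
  qed
  moreover have "inj_on (\<lambda>i. \<gamma> i *v e1) {..<K}"
  proof (rule inj_onI)
    fix i j assume "i \<in> {..<K}" "j \<in> {..<K}" "\<gamma> i *v e1 = \<gamma> j *v e1"
    then have "y i = y j"
      using \<gamma>(2) by (metis lessThan_iff vector_2(2))
    then show "i = j"
      using h by (simp add: y_def)
  qed
  ultimately show ?thesis
    using \<gamma>(1) by blast
qed

end
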